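(* The operator $\neg:\tilde{\mathbb{I}}\to\tilde{\mathbb{I}}$ given, for $\alpha=\langle\mu_\alpha,\nu_\alpha\rangle\in\tilde{\mathbb{I}}$, by $$\neg\alpha=\begin{cases}\left\langle\frac{1-\mu_\alpha-\nu_\alpha}{2},\frac{1+\mu_\alpha-3\nu_\alpha}{2}\right\rangle, & \mu_\alpha>\nu_\alpha,\\ \left\langle\frac12-\mu_\alpha,\frac12-\nu_\alpha\right\rangle, & \mu_\alpha=\nu_\alpha,\\ \left\langle\frac{1+\nu_\alpha-3\mu_\alpha}{2},\frac{1-\mu_\alpha-\nu_\alpha}{2}\right\rangle, & \mu_\alpha<\nu_\alpha,\end{cases}$$ is a strong negation on $(\tilde{\mathbb{I}},\leq_{\mathrm{XY}})$.
   Context: $\tilde{\mathbb{I}}=\{\langle\mu,\nu\rangle\in[0,1]^2 \mid \mu+\nu\le 1\}$ is the set of intuitionistic fuzzy values. For $\alpha=\langle\mu_\alpha,\nu_\alpha\rangle\in\tilde{\mathbb{I}}$ put $s(\alpha)=\mu_\alpha-\nu_\alpha$ and $h(\alpha)=\mu_\alpha+\nu_\alpha$. Define $\alpha<_{\mathrm{XY}}\beta$ iff $s(\alpha)<s(\beta)$, or $s(\alpha)=s(\beta)$ and $h(\alpha)<h(\beta)$; $\alpha\leq_{\mathrm{XY}}\beta$ iff $\alpha<_{\mathrm{XY}}\beta$ or $\alpha=\beta$. The bottom and top elements under $\leq_{\mathrm{XY}}$ are $\langle 0,1\rangle$ and $\langle 1,0\rangle$. A negation on a bounded lattice $L$ with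 bottom $\mathbf{0}$ and top $\mathbf{1}$ is a decreasing (order-reversing) map $N:L\to L$ with $N(\mathbf{0})=\mathbf{1}$ and $N(\mathbf{1})=\mathbf{0}$; it is a strong negation if in addition $N(N(x))=x$ for all $x\in L$. *)

theory Defs
  imports Complex_Main "HOL-Algebra.Lattice"
begin

definition IFV :: "(real \<times> real) set" where
  "IFV = {(\<mu>, \<nu>). \<mu> \<in> {0..1} \<and> \<nu> \<in> {0..1} \<and> \<mu> + \<nu> \<le> 1}"

definition score :: "real \<times> real \<Rightarrow> real" where
  "score \<alpha> = fst \<alpha> - snd \<alpha>"

definition accuracy :: "real \<times> real \<Rightarrow> real" where
  "accuracy \<alpha> = fst \<alpha> + snd \<alpha>"

definition less_XY :: "real \<times> real \<Rightarrow> real \<times> real \<Rightarrow> bool" where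
  "less_XY \<alpha> \<beta> \<longleftrightarrow>
     score \<alpha> < score \<beta> \<or> score \<alpha> = score \<beta> \<and> accuracy \<alpha> < accuracy \<beta>"

definition le_XY :: "real \<times> real \<Rightarrow> real \<times> real \<Rightarrow> bool" where
  "le_XY \<alpha> \<beta> \<longleftrightarrow> less_XY \<alpha> \<beta> \<or> \<alpha> = \<beta>"

definition IFV_XY :: "(real \<times> real) gorder" where
  "IFV_XY = \<lparr>carrier = IFV, eq = (=), le = le_XY\<rparr>"

definition negation :: "('a, 'b) gorder_scheme \<Rightarrow> ('a \<Rightarrow> 'a) \<Rightarrow> bool" where
  "negation L N \<longleftrightarrow>
     bounded_lattice L \<and>
     N \<in> carrier L \<rightarrow> carrier L \<and>
     (\<forall>x\<in>carrier L. \<forall>y\<in>carrier L. x \<sqsubseteq>\<^bsub>L\<^esub> y \<longrightarrow> N y \<sqsubseteq>\<^bsub>L\<^esub> N x) \<and>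
     N \<bottom>\<^bsub>L\<^esub> = \<top>\<^bsub>L\<^esub> \<and> N \<top>\<^bsub>L\<^esub> = \<bottom>\<^bsub>L\<^esub>"

definition strong_negation :: "('a, 'b) gorder_scheme \<Rightarrow> ('a \<Rightarrow> 'a) \<Rightarrow> bool" where
  "strong_negation L N \<longleftrightarrow> negation L N \<and> (\<forall>x\<in>carrier L. N (N x) = x)"

text \<open>Only the values on \<^const>\<open>IFV\<close> matter.\<close>

definition ifv_neg :: "real \<times> real \<Rightarrow> real \<times> real" where
  "ifv_neg = (\<lambda>(\<mu>, \<nu>).
     if \<mu> > \<nu> then ((1 - \<mu> - \<nu>) / 2, (1 + \<mu> - 3 * \<nu>) / 2)
     else if \<mu> = \<nu> then (1 / 2 - \<mu>, 1 / 2 - \<nu>)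
     else ((1 + \<nu> - 3 * \<mu>) / 2, (1 - \<mu> - \<nu>) / 2))"

end

theory Submission
  imports Defs
begin

text \<open>In the coordinates (score, accuracy) = $(s, h)$ the carrier is $|s| \<le> h \<le> 1$, the order is
  lexicographic, and the operator becomes $(s, h) \<mapsto> (-s, 1 + |s| - h)$: it reverses the scores
  and reflects the interval $[|s|, 1]$ of accuracies available at score $\<plusminus>s$.\<close>

lemma eq_iff_score_accuracy: "\<alpha> = \<beta> \<longleftrightarrow> score \<alpha> = score \<beta> \<and> accuracy \<alpha> = accuracy \<beta>"
  by (auto simp: score_def accuracy_def prod_eq_iff)

text \<open>Since \<mu> = (h + s)/2 and \<nu> = (h - s)/2, the bound |s| \<le> h makes both
  nonnegative; with h \<le> 1 neither can then exceed 1.\<close>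

lemma mem_IFV_iff: "\<alpha> \<in> IFV \<longleftrightarrow> \<bar>score \<alpha>\<bar> \<le> accuracy \<alpha> \<and> accuracy \<alpha> \<le> 1"
  by (cases \<alpha>) (auto simp: IFV_def score_def accuracy_def)

lemma le_XY_iff:
  "le_XY \<alpha> \<beta> \<longleftrightarrow> score \<alpha> < score \<beta> \<or> score \<alpha> = score \<beta> \<and> accuracy \<alpha> \<le> accuracy \<beta>"
  by (auto simp: le_XY_def less_XY_def eq_iff_score_accuracy)

lemma score_ifv_neg: "score (ifv_neg \<alpha>) = - score \<alpha>"
  by (cases \<alpha>) (auto simp: ifv_neg_def score_def field_simps)

text \<open>All three branches have coordinate sum 1 - 2 min(\<mu>, \<nu>), and 2 min(\<mu>, \<nu>)
  = h - |s|.\<close>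

lemma accuracy_ifv_neg: "accuracy (ifv_neg \<alpha>) = 1 + \<bar>score \<alpha>\<bar> - accuracy \<alpha>"
  by (cases \<alpha>) (auto simp: ifv_neg_def score_def accuracy_def field_simps)

lemma ifv_neg_involutive: "ifv_neg (ifv_neg \<alpha>) = \<alpha>"
  by (simp add: eq_iff_score_accuracy score_ifv_neg accuracy_ifv_neg)

lemma ifv_neg_closed: "\<alpha> \<in> IFV \<Longrightarrow> ifv_neg \<alpha> \<in> IFV"
  by (simp add: mem_IFV_iff score_ifv_neg accuracy_ifv_neg)

text \<open>Distinct scores are reversed by the sign change; at equal scores |s| agrees, so the term
  -h reverses the accuracies.\<close>

lemma ifv_neg_antitone: "le_XY \<alpha> \<beta> \<Longrightarrow> le_XY (ifv_neg \<beta>) (ifv_neg \<alpha>)"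
  by (auto simp: le_XY_iff score_ifv_neg accuracy_ifv_neg)

text \<open>On \<open>IFV\<close> the score is at least -1, and score -1 forces accuracy 1, so no
  other point ties with (0, 1) despite its maximal accuracy.\<close>

lemma least_IFV_XY: "least IFV_XY (0, 1) (carrier IFV_XY)"
  by (auto simp: least_def IFV_XY_def mem_IFV_iff le_XY_iff score_def accuracy_def)

lemma greatest_IFV_XY: "greatest IFV_XY (1, 0) (carrier IFV_XY)"
  by (auto simp: greatest_def IFV_XY_def mem_IFV_iff le_XY_iff score_def accuracy_def)

lemma total_order_IFV_XY: "total_order IFV_XY"
  by unfold_locales (auto simp: IFV_XY_def le_XY_iff eq_iff_score_accuracy)

lemma bounded_lattice_IFV_XY: "bounded_lattice IFV_XY"
proof -
  \<comment> \<open>A chain is a lattice, with max and min as join and meet; this leaves the two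
    bounds.\<close>
  interpret total_order IFV_XY
    by (rule total_order_IFV_XY)
  show ?thesis
    by unfold_locales (use least_IFV_XY greatest_IFV_XY in blast)+
qed

text \<open>Least and greatest elements are unique, which identifies the abstract bounds that
  \<open>negation\<close> refers to.\<close>

lemma bottom_IFV_XY: "\<bottom>\<^bsub>IFV_XY\<^esub> = (0, 1)"
  and top_IFV_XY: "\<top>\<^bsub>IFV_XY\<^esub> = (1, 0)"
proof -
  interpret bounded_lattice IFV_XY
    by (rule bounded_lattice_IFV_XY)
  show "\<bottom>\<^bsub>IFV_XY\<^esub> = (0, 1)"
    using least_IFV_XY by (intro bottom_eq [symmetric]) (auto simp: least_def)
  show "\<top>\<^bsub>IFV_XY\<^esub> = (1, 0)"
    using greatest_IFV_XY by (intro top_eq [symmetric]) (auto simp: greatest_def)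
qed

theorem corollary4p1:
  shows "strong_negation IFV_XY ifv_neg"
proof -
  have "ifv_neg (0, 1) = (1, 0)" "ifv_neg (1, 0) = (0, 1)"
    by (simp_all add: ifv_neg_def)
  moreover have "carrier IFV_XY = IFV" "le IFV_XY = le_XY"
    by (simp_all add: IFV_XY_def)
  ultimately show ?thesis
    by (simp add: strong_negation_def negation_def bounded_lattice_IFV_XY bottom_IFV_XY top_IFV_XY
        ifv_neg_closed ifv_neg_antitone ifv_neg_involutive)
qed

end
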